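(* Let $d\ge1$, $M>0$, and let $\mathbf F\in C^\infty([-M,M],\mathbb R^d)$. Let $\alpha_{\sup}=\alpha_{\sup}[\mathbf F,M]$ and $d_{\mathbf F}$ be as defined in the context. Then $$\alpha_{\sup}=\frac1{d_{\mathbf F}}\le\frac1d ,$$ with the convention $1/(+\infty)=0$. Furthermore, when $\alpha_{\sup}>0$ there exists $\underline u\in[-M,M]$ such that $d_{\mathbf F}=d_{\mathbf F}[\underline u]$.
   Context: Let $\mathbf a=\mathbf F'$. For $(\tau,\xi)\in\mathbb R\times\mathbb R^d$ with $\tau^2+|\xi|^2=1$ and $\delta>0$ let $W_\delta(\tau,\xi)=\{v\in[-M,M]:\ |\tau+\mathbf a(v)\cdot\xi|\le\delta\}$ and let $|W_\delta(\tau,\xi)|$ be its Lebesgue measure. $\alpha_{\sup}[\mathbf F,M]$ is the supremum of all $\alpha>0$ for which there is $C=C_\alpha>0$ with $\sup_{\tau^2+|\xi|^2=1}|W_\delta(\tau,\xi)|\le C\delta^\alpha$ for all $\delta>0$ ($\alpha_{\sup}=0$ if there is no such $\alpha$). For $u\in[-M,M]$, $$d_{\mathbf F}[u]=\inf\{k\ge1:\ \operatorname{rank}\{\mathbf F''(u),\dots,\mathbf F^{(k+1)}(u)\}=d\}\quad(\inf\emptyset=+\infty),\qquad d_{\mathbf F}=\sup_{|u|\le M}d_{\mathbf F}[u]\in\{d,d+1,\dots\}\cup\{+\infty\}.$$ *)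

theory Defs
  imports "HOL-Analysis.Analysis"
begin

(* Iterated derivatives relative to a set S of reals. For S = {-M..M} with M > 0 these are
   the usual derivatives inside and the one-sided ones at the endpoints; on S they depend
   only on the values of f on S. *)
primrec nth_deriv_on :: "real set \<Rightarrow> nat \<Rightarrow> (real \<Rightarrow> 'a::real_normed_vector) \<Rightarrow> real \<Rightarrow> 'a" where
  "nth_deriv_on S 0 f = f"
| "nth_deriv_on S (Suc k) f = (\<lambda>u. vector_derivative (nth_deriv_on S k f) (at u within S))"

(* Continuity of each derivative follows from differentiability at the next order. *)
definition smooth_on_interval :: "real set \<Rightarrow> (real \<Rightarrow> 'a::real_normed_vector) \<Rightarrow> bool" where
  "smooth_on_interval S f \<longleftrightarrow> (\<forall>k. nth_deriv_on S k f differentiable_on S)"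

definition nondeg_set ::
    "(real \<Rightarrow> real ^ 'd::finite) \<Rightarrow> real \<Rightarrow> real \<Rightarrow> real \<Rightarrow> real ^ 'd \<Rightarrow> real set" where
  "nondeg_set F M \<delta> \<tau> \<xi> =
     {v \<in> {-M..M}. \<bar>\<tau> + nth_deriv_on {-M..M} 1 F v \<bullet> \<xi>\<bar> \<le> \<delta>}"

definition nondeg_exponents :: "(real \<Rightarrow> real ^ 'd::finite) \<Rightarrow> real \<Rightarrow> real set" where
  "nondeg_exponents F M =
     {\<alpha>. \<alpha> > 0 \<and> (\<exists>C>0. \<forall>\<delta>>0.
        (SUP (\<tau>, \<xi>) \<in> {(\<tau>, \<xi>). \<tau>\<^sup>2 + (norm \<xi>)\<^sup>2 = 1}. emeasure lebesgue (nondeg_set F M \<delta> \<tau> \<xi>))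
          \<le> ennreal (C * \<delta> powr \<alpha>))}"

(* The empty case is separate because the supremum of the empty set in ereal is -\<infinity>. *)
definition alpha_sup :: "(real \<Rightarrow> real ^ 'd::finite) \<Rightarrow> real \<Rightarrow> ereal" where
  "alpha_sup F M =
     (if nondeg_exponents F M = {} then 0 else (SUP \<alpha> \<in> nondeg_exponents F M. ereal \<alpha>))"

(* The rank of a family of vectors is the dimension of its span, which is the library's dim.
   In enat the infimum of the empty set is \<infinity>. *)
definition d_at :: "(real \<Rightarrow> real ^ 'd::finite) \<Rightarrow> real \<Rightarrow> real \<Rightarrow> enat" where
  "d_at F M u =
     (INF k \<in> {k. k \<ge> 1 \<and> dim {nth_deriv_on {-M..M} j F u | j. 2 \<le> j \<and> j \<le> k + 1} = CARD('d)}.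
        enat k)"

definition d_max :: "(real \<Rightarrow> real ^ 'd::finite) \<Rightarrow> real \<Rightarrow> enat" where
  "d_max F M = (SUP u \<in> {-M..M}. d_at F M u)"

end

(* Write g = tau + F' . xi. If the family F''(u), ..., F^(n)(u) does not span R^d, choose xi
   orthogonal to it and tau with g(u) = 0: then g vanishes to order n at u, so the set where
   |g| <= delta contains an interval of length comparable to delta^(1/n), and every exponent is at
   most 1/n. Conversely, if d_F = K is finite, then |g| + |g'| + ... + |g^(K)| is bounded below by
   compactness; on each of finitely many short intervals, chosen independently of (tau, xi), one of
   these derivatives is bounded away from 0, and a van der Corput type sublevel estimate bounds the
   measure there by a multiple of delta^(1/K). *)

theory Submission
  imports Defs
begin

section \<open>One-variable calculus: sublevel sets and order of vanishing\<close>

text \<open>Arbitrary intervals occur because the pieces used below are cut out by open balls and by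
  level conditions. Derivatives are taken within \<open>S\<close> because included endpoints have
  only one-sided ones.\<close>

lemma interval_mvt:
  fixes f f' :: "real \<Rightarrow> real"
  assumes "is_interval S" "x \<in> S" "y \<in> S" "x \<le> y"
    and der: "\<And>v. v \<in> S \<Longrightarrow> (f has_real_derivative f' v) (at v within S)"
  obtains z where "z \<in> S" "x \<le> z" "z \<le> y" "f y - f x = f' z * (y - x)"
proof -
  have sub: "{x..y} \<subseteq> S"
    using assms(1-3) by (meson atLeastAtMost_iff mem_is_interval_1_I subsetI)
  have "\<exists>z\<in>{x..y}. f y - f x = (*) (f' z) (y - x)"
  proof (rule mvt_very_simple[OF \<open>x \<le> y\<close>])
    fix z assume "x \<le> z" "z \<le> y"
    then have "z \<in> S" using sub by auto
    then show "(f has_derivative (*) (f' z)) (at z within {x..y})"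
      using der has_field_derivative_subset[OF _ sub] by (simp add: has_field_derivative_def)
  qed
  then show thesis using that sub by auto
qed

text \<open>Van der Corput type estimate: a set where \<^term>\<open>\<bar>g k v\<bar> \<le> c * \<rho>\<close> has diameter at most
  \<^term>\<open>2 * \<rho>\<close>, and off it the induction hypothesis applies with \<^term>\<open>c * \<rho>\<close> in place of \<^term>\<open>c\<close>.
  Only \<^term>\<open>\<delta> < c * \<rho> ^ k\<close> is carried along, so that no fractional power of \<^term>\<open>\<delta>\<close> occurs.\<close>

lemma sublevel_cover:
  fixes g :: "nat \<Rightarrow> real \<Rightarrow> real"
  assumes "is_interval S"
    and "\<And>i v. i < k \<Longrightarrow> v \<in> S \<Longrightarrow> (g i has_real_derivative g (Suc i) v) (at v within S)"
    and "\<And>v. v \<in> S \<Longrightarrow> c \<le> g k v"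
    and "0 < c" "0 < \<rho>" "\<delta> < c * \<rho> ^ k"
  shows "\<exists>P. finite P \<and> card P < 2 ^ k \<and> {v \<in> S. \<bar>g 0 v\<bar> \<le> \<delta>} \<subseteq> (\<Union>p\<in>P. {p..p + 2 * \<rho>})"
  using assms
proof (induction k arbitrary: S g c)
  case 0
  then have "{v \<in> S. \<bar>g 0 v\<bar> \<le> \<delta>} = {}" by fastforce
  then show ?case by (intro exI[of _ "{}"]) simp
next
  case (Suc k)
  note S = Suc.prems(1) and der = Suc.prems(2) and low = Suc.prems(3)
  define h where "h = g k"
  have grow: "c * (y - x) \<le> h y - h x" if xy: "x \<in> S" "y \<in> S" "x \<le> y" for x y
  proof -
    obtain z where "z \<in> S" "h y - h x = g (Suc k) z * (y - x)"
      using interval_mvt[OF S xy, of h "g (Suc k)"] der[of k] unfolding h_def by auto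
    then show ?thesis using low[of z] \<open>x \<le> y\<close> by (simp add: mult_right_mono)
  qed
  have mono: "h x \<le> h y" if "x \<in> S" "y \<in> S" "x \<le> y" for x y
    using grow[OF that] that \<open>0 < c\<close> by (smt (verit) mult_nonneg_nonneg)
  define S1 where "S1 = {v \<in> S. c * \<rho> \<le> h v}"
  define S2 where "S2 = {v \<in> S. h v \<le> - (c * \<rho>)}"
  define S3 where "S3 = {v \<in> S. \<bar>h v\<bar> \<le> c * \<rho>}"
  \<comment> \<open>As \<open>h\<close> is nondecreasing, \<open>S1\<close> is closed upwards and
    \<open>S2\<close> downwards within the interval \<open>S\<close>.\<close>
  have int: "is_interval S1" "is_interval S2"
    using S mono unfolding is_interval_1 S1_def S2_def by (smt (verit) mem_Collect_eq)+
  have sub: "S1 \<subseteq> S" "S2 \<subseteq> S" by (auto simp: S1_def S2_def)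
  have pos: "0 < c * \<rho>" "\<delta> < c * \<rho> * \<rho> ^ k" using Suc.prems by (auto simp: mult.assoc)
  obtain P1 where P1: "finite P1" "card P1 < 2 ^ k"
      "{v \<in> S1. \<bar>g 0 v\<bar> \<le> \<delta>} \<subseteq> (\<Union>p\<in>P1. {p..p + 2 * \<rho>})"
  proof -
    have "(g i has_real_derivative g (Suc i) v) (at v within S1)" if "i < k" "v \<in> S1" for i v
      using der[of i v] that sub(1) by (meson has_field_derivative_subset less_SucI subsetD)
    then show thesis
      using Suc.IH[of S1 g "c * \<rho>"] int pos \<open>0 < \<rho>\<close> that unfolding S1_def h_def by blast
  qed
  \<comment> \<open>On \<open>S2\<close> it is \<open>- g k\<close> that is bounded below, so the
    induction hypothesis is applied to the negated sequence.\<close>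
  obtain P2 where P2: "finite P2" "card P2 < 2 ^ k"
      "{v \<in> S2. \<bar>- g 0 v\<bar> \<le> \<delta>} \<subseteq> (\<Union>p\<in>P2. {p..p + 2 * \<rho>})"
  proof -
    have d: "((\<lambda>v. - g i v) has_real_derivative - g (Suc i) v) (at v within S2)"
      if "i < k" "v \<in> S2" for i v
      using der[of i v] that sub(2)
      by (intro DERIV_minus) (meson has_field_derivative_subset less_SucI subsetD)
    have "c * \<rho> \<le> - g k v" if "v \<in> S2" for v using that unfolding S2_def h_def by auto
    then show thesis
      using Suc.IH[of S2 "\<lambda>i v. - g i v" "c * \<rho>"] d int pos \<open>0 < \<rho>\<close> that by blast
  qed
  obtain p where p: "S3 \<subseteq> {p..p + 2 * \<rho>}"
  proof (cases "S3 = {}")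
    case False
    have diam: "y \<le> x + 2 * \<rho>" if "x \<in> S3" "y \<in> S3" for x y
    proof (cases "x \<le> y")
      case True
      have "c * (y - x) \<le> c * (2 * \<rho>)"
        using grow[of x y] that True by (auto simp: S3_def abs_le_iff)
      then show ?thesis using \<open>0 < c\<close> by simp
    qed (use \<open>0 < \<rho>\<close> in auto)
    obtain x0 where "x0 \<in> S3" using False by auto
    then have "bdd_below S3" using diam by (intro bdd_belowI[of _ "x0 - 2 * \<rho>"]) force
    \<comment> \<open>Every point of \<open>S3\<close> is a lower bound for \<open>S3\<close> after
      subtracting the diameter bound, so an interval starting at the infimum captures the whole
      set.\<close>
    moreover have "y - 2 * \<rho> \<le> Inf S3" if "y \<in> S3" for y
      using diam[OF _ that] False by (intro cInf_greatest) force+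
    ultimately have "S3 \<subseteq> {Inf S3..Inf S3 + 2 * \<rho>}" by (force intro: cInf_lower)
    then show thesis by (rule that)
  qed auto
  \<comment> \<open>The strict bounds leave room for one extra interval: (2^k - 1) + (2^k - 1) + 1 <
    2^(k+1).\<close>
  have "card (insert p (P1 \<union> P2)) \<le> Suc (card P1 + card P2)"
    by (metis Suc_le_mono card_Un_le card_insert_le_m1 card_insert_if P1(1) P2(1) finite_UnI
        le_SucI)
  then have "card (insert p (P1 \<union> P2)) < 2 ^ Suc k" using P1 P2 by simp
  moreover have "{v \<in> S. \<bar>g 0 v\<bar> \<le> \<delta>} \<subseteq> (\<Union>p\<in>insert p (P1 \<union> P2). {p..p + 2 * \<rho>})"
  proof
    fix v assume v: "v \<in> {v \<in> S. \<bar>g 0 v\<bar> \<le> \<delta>}"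
    then consider "v \<in> S1" | "v \<in> S2" | "v \<in> S3" unfolding S1_def S2_def S3_def by fastforce
    then show "v \<in> (\<Union>p\<in>insert p (P1 \<union> P2). {p..p + 2 * \<rho>})"
      using v P1(3) P2(3) p by cases fastforce+
  qed
  ultimately show ?case using P1 P2 by (intro exI[of _ "insert p (P1 \<union> P2)"]) auto
qed

text \<open>Taylor's bound without the factor 1/n!, which does not affect exponents. The mean value
  theorem gives \<open>g 0 v = g 1 z * (v - u)\<close> with \<open>z\<close> between
  \<open>u\<close> and \<open>v\<close>, and induction on the shifted sequence bounds
  \<open>g 1 z\<close>.\<close>

lemma vanishing_order_bound:
  fixes g :: "nat \<Rightarrow> real \<Rightarrow> real"
  assumes S: "is_interval S" and u: "u \<in> S"
    and "\<And>i v. i < n \<Longrightarrow> v \<in> S \<Longrightarrow> (g i has_real_derivative g (Suc i) v) (at v within S)"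
    and "\<And>i. i < n \<Longrightarrow> g i u = 0"
    and "\<And>v. v \<in> S \<Longrightarrow> \<bar>g n v\<bar> \<le> B"
    and "v \<in> S"
  shows "\<bar>g 0 v\<bar> \<le> B * \<bar>v - u\<bar> ^ n"
  using assms(3-)
proof (induction n arbitrary: g v)
  case (Suc n)
  have IH: "\<bar>g 1 w\<bar> \<le> B * \<bar>w - u\<bar> ^ n" if "w \<in> S" for w
    using Suc.IH[of "\<lambda>i. g (Suc i)" w] Suc.prems that by simp
  have B: "0 \<le> B" using Suc.prems(3)[OF u] by linarith
  have "\<exists>z\<in>S. \<bar>z - u\<bar> \<le> \<bar>v - u\<bar> \<and> \<bar>g 0 v\<bar> = \<bar>g 1 z\<bar> * \<bar>v - u\<bar>"
  proof (cases "u \<le> v")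
    case True
    show ?thesis
      by (rule interval_mvt[OF S u \<open>v \<in> S\<close> True, of "g 0" "g 1"])
        (use Suc.prems in \<open>auto simp: abs_mult intro!: bexI\<close>)
  next
    case False
    then have "v \<le> u" by simp
    obtain z where z: "z \<in> S" "v \<le> z" "z \<le> u" "g 0 u - g 0 v = g 1 z * (u - v)"
      by (rule interval_mvt[OF S \<open>v \<in> S\<close> u \<open>v \<le> u\<close>, of "g 0" "g 1"])
        (use Suc.prems in auto)
    have "\<bar>g 0 v\<bar> = \<bar>g 1 z * (u - v)\<bar>"
      using z(4) Suc.prems(2)[of 0] by (metis abs_minus_cancel diff_0 zero_less_Suc)
    then show ?thesis using z \<open>v \<le> u\<close> by (intro bexI[of _ z]) (auto simp: abs_mult)
  qed
  then obtain z where z: "z \<in> S" "\<bar>z - u\<bar> \<le> \<bar>v - u\<bar>" "\<bar>g 0 v\<bar> = \<bar>g 1 z\<bar> * \<bar>v - u\<bar>" by auto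
  have "\<bar>g 1 z\<bar> \<le> B * \<bar>v - u\<bar> ^ n"
    using IH[OF z(1)] power_mono[OF z(2), of n] B by (smt (verit) abs_ge_zero mult_left_mono)
  then have "\<bar>g 1 z\<bar> * \<bar>v - u\<bar> \<le> (B * \<bar>v - u\<bar> ^ n) * \<bar>v - u\<bar>" by (rule mult_right_mono) simp
  then show ?case using z(3) by (simp add: mult_ac)
qed simp

section \<open>Derivatives of the symbol and its sublevel sets\<close>

lemma smooth_has_vector_derivative:
  assumes "smooth_on_interval S F" "v \<in> S"
  shows "(nth_deriv_on S k F has_vector_derivative nth_deriv_on S (Suc k) F v) (at v within S)"
  using assms by (simp add: smooth_on_interval_def differentiable_on_def vector_derivative_works)

lemma smooth_continuous_on: "smooth_on_interval S F \<Longrightarrow> continuous_on S (nth_deriv_on S k F)"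
  by (simp add: smooth_on_interval_def differentiable_imp_continuous_on)

text \<open>The value at \<^term>\<open>v\<close> of the \<^term>\<open>j\<close>-th derivative of \<open>\<tau> + F' \<bullet> \<xi>\<close>.\<close>

definition symbol_deriv ::
    "(real \<Rightarrow> real ^ 'd::finite) \<Rightarrow> real \<Rightarrow> real \<Rightarrow> real ^ 'd \<Rightarrow> nat \<Rightarrow> real \<Rightarrow> real" where
  "symbol_deriv F M \<tau> \<xi> j v = (if j = 0 then \<tau> else 0) + nth_deriv_on {-M..M} (Suc j) F v \<bullet> \<xi>"

lemma nondeg_set_altdef: "nondeg_set F M \<delta> \<tau> \<xi> = {v \<in> {-M..M}. \<bar>symbol_deriv F M \<tau> \<xi> 0 v\<bar> \<le> \<delta>}"
  by (simp add: nondeg_set_def symbol_deriv_def)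

lemma symbol_deriv_has_derivative:
  assumes "smooth_on_interval {-M..M} F" "v \<in> {-M..M}"
  shows "(symbol_deriv F M \<tau> \<xi> j has_real_derivative symbol_deriv F M \<tau> \<xi> (Suc j) v)
           (at v within {-M..M})"
proof -
  have "((\<lambda>v. nth_deriv_on {-M..M} (Suc j) F v \<bullet> \<xi>) has_vector_derivative
      nth_deriv_on {-M..M} (Suc (Suc j)) F v \<bullet> \<xi>) (at v within {-M..M})"
    by (intro bounded_linear.has_vector_derivative[OF bounded_linear_inner_left]
        smooth_has_vector_derivative assms)
  then have "((\<lambda>v. (if j = 0 then \<tau> else 0) + nth_deriv_on {-M..M} (Suc j) F v \<bullet> \<xi>)
      has_vector_derivative 0 + nth_deriv_on {-M..M} (Suc (Suc j)) F v \<bullet> \<xi>) (at v within {-M..M})"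
    by (intro derivative_intros)
  then show ?thesis
    by (simp add: symbol_deriv_def[abs_def] has_real_derivative_iff_has_vector_derivative)
qed

lemma continuous_on_symbol_deriv:
  assumes "smooth_on_interval {-M..M} F"
  shows "continuous_on {-M..M} (symbol_deriv F M \<tau> \<xi> j)"
  unfolding symbol_deriv_def[abs_def]
  by (intro continuous_intros smooth_continuous_on assms)

text \<open>Bounding \<open>emeasure\<close> from below by monotonicity requires the larger set to
  be measurable, since \<open>emeasure\<close> is 0 on nonmeasurable sets.\<close>

lemma nondeg_set_measurable:
  assumes "smooth_on_interval {-M..M} F"
  shows "nondeg_set F M \<delta> \<tau> \<xi> \<in> sets lebesgue"
proof -
  have "closed ({-M..M} \<inter> (\<lambda>v. \<bar>symbol_deriv F M \<tau> \<xi> 0 v\<bar>) -` {..\<delta>})"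
    by (intro continuous_closed_preimage continuous_intros continuous_on_symbol_deriv assms)
  also have "\<dots> = nondeg_set F M \<delta> \<tau> \<xi>" by (auto simp: nondeg_set_altdef)
  finally show ?thesis by (simp add: borel_closed)
qed

lemma nondeg_exponents_iff:
  "\<alpha> \<in> nondeg_exponents F M \<longleftrightarrow> \<alpha> > 0 \<and> (\<exists>C>0. \<forall>\<delta>>0. \<forall>\<tau> \<xi>. \<tau>\<^sup>2 + (norm \<xi>)\<^sup>2 = 1 \<longrightarrow>
     emeasure lebesgue (nondeg_set F M \<delta> \<tau> \<xi>) \<le> ennreal (C * \<delta> powr \<alpha>))"
  by (auto simp: nondeg_exponents_def SUP_le_iff)

section \<open>The rank condition in terms of orthogonal vectors\<close>

text \<open>Orders 2 to \<open>k + 1\<close> of \<open>F\<close> are orders 1 to \<open>k\<close> of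
  the symbol; order 0 is left out because \<open>\<tau>\<close> can be adjusted to control
  it.\<close>

definition deriv_family :: "(real \<Rightarrow> real ^ 'd::finite) \<Rightarrow> real \<Rightarrow> real \<Rightarrow> nat \<Rightarrow> (real ^ 'd) set" where
  "deriv_family F M u k = {nth_deriv_on {-M..M} j F u | j. 2 \<le> j \<and> j \<le> k + 1}"

text \<open>Infinite \<open>d_at\<close> needs no separate case: the right-hand side is then
  vacuously true.\<close>

lemma le_d_at_iff:
  "enat n \<le> d_at F M u \<longleftrightarrow> (\<forall>k\<ge>1. dim (deriv_family F M u k) = CARD('d) \<longrightarrow> n \<le> k)"
  for F :: "real \<Rightarrow> real ^ 'd::finite"
  by (auto simp: d_at_def le_INF_iff deriv_family_def)

text \<open>A family of at most \<open>k\<close> vectors has rank at most \<open>k\<close>. This is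
  the source of the bound 1/d in the theorem.\<close>

lemma card_le_d_at: "enat CARD('d) \<le> d_at F M u" for F :: "real \<Rightarrow> real ^ 'd::finite"
proof -
  have "dim (deriv_family F M u k) \<le> k" for k
  proof -
    have eq: "deriv_family F M u k = (\<lambda>j. nth_deriv_on {-M..M} j F u) ` {2..k + 1}"
      by (auto simp: deriv_family_def)
    have "dim (deriv_family F M u k) \<le> card (deriv_family F M u k)"
      by (intro dim_le_card') (simp add: eq)
    also have "\<dots> \<le> card {2..k + 1}" unfolding eq by (intro card_image_le) simp
    finally show ?thesis by simp
  qed
  then show ?thesis unfolding le_d_at_iff by metis
qed

text \<open>The first \<open>n\<close> vectors of the family span a proper subspace, which has a
  nonzero orthogonal vector.\<close>

lemma annihilator_exists:
  fixes F :: "real \<Rightarrow> real ^ 'd::finite"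
  assumes "enat (Suc n) \<le> d_at F M u"
  obtains \<xi> where "\<xi> \<noteq> 0" "\<And>j. 1 \<le> j \<Longrightarrow> j \<le> n \<Longrightarrow> nth_deriv_on {-M..M} (Suc j) F u \<bullet> \<xi> = 0"
proof -
  have "dim (deriv_family F M u n) \<noteq> CARD('d)"
  \<comment> \<open>The infimum in \<open>d_at\<close> ranges over \<open>k \<ge> 1\<close> only, so
    the empty family is treated by hand.\<close>
  proof (cases "n = 0")
    case True
    then have "deriv_family F M u n = {}" by (auto simp: deriv_family_def)
    then show ?thesis by simp
  next
    case False
    then show ?thesis using assms[unfolded le_d_at_iff, rule_format, of n] by auto
  qed
  then have "dim (deriv_family F M u n) < DIM(real ^ 'd)"
    using dim_subset_UNIV[of "deriv_family F M u n"] by simp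
  then obtain \<xi> where "\<xi> \<noteq> 0" "\<And>y. y \<in> span (deriv_family F M u n) \<Longrightarrow> orthogonal \<xi> y"
    using orthogonal_to_subspace_exists by blast
  moreover have "nth_deriv_on {-M..M} (Suc j) F u \<in> deriv_family F M u n" if "1 \<le> j" "j \<le> n" for j
    using that by (auto simp: deriv_family_def simp del: nth_deriv_on.simps intro!: exI[of _ "Suc j"])
  ultimately show thesis
    using that[of \<xi>] unfolding orthogonal_def by (metis inner_commute span_base)
qed

text \<open>If all these derivatives vanished, \<open>\<xi>\<close> would be orthogonal to a
  spanning family, hence 0; order 0 would then give \<open>\<tau> = 0\<close>, against the
  normalisation.\<close>

lemma symbol_deriv_nonzero:
  fixes F :: "real \<Rightarrow> real ^ 'd::finite"
  assumes "d_at F M u \<le> enat K" "\<tau>\<^sup>2 + (norm \<xi>)\<^sup>2 = 1"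
  shows "\<exists>j\<le>K. symbol_deriv F M \<tau> \<xi> j u \<noteq> 0"
proof (rule ccontr)
  assume "\<not> ?thesis"
  then have zero: "symbol_deriv F M \<tau> \<xi> j u = 0" if "j \<le> K" for j using that by blast
  have "\<not> enat (Suc K) \<le> d_at F M u"
    using assms(1) by (meson enat_ord_simps(1) not_less_eq_eq order_trans order_refl)
  then obtain k where k: "k \<le> K" "dim (deriv_family F M u k) = CARD('d)"
    unfolding le_d_at_iff by (metis not_less_eq_eq)
  have "orthogonal \<xi> y" if y: "y \<in> deriv_family F M u k" for y
  proof -
    obtain j where j: "y = nth_deriv_on {-M..M} j F u" "2 \<le> j" "j \<le> k + 1"
      using y by (auto simp: deriv_family_def)
    then obtain i where "j = Suc i" "i \<noteq> 0" by (cases j) auto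
    then show ?thesis using zero[of i] j k
      by (simp add: symbol_deriv_def orthogonal_def inner_commute del: nth_deriv_on.simps)
  qed
  moreover have "span (deriv_family F M u k) = UNIV" using k(2) by (simp add: dim_eq_full[symmetric])
  ultimately have "orthogonal \<xi> \<xi>" by (metis UNIV_I orthogonal_to_span)
  then have "\<xi> = 0" by (simp add: orthogonal_self)
  then show False using zero[of 0] assms(2) by (simp add: symbol_deriv_def)
qed

section \<open>Counting and measuring covers by intervals\<close>

lemma UN_cover_card:
  assumes "finite U" "\<And>u. u \<in> U \<Longrightarrow> \<exists>P. finite P \<and> card P \<le> m \<and> A u \<subseteq> (\<Union>p\<in>P. I p)"
  shows "\<exists>P. finite P \<and> card P \<le> card U * m \<and> (\<Union>u\<in>U. A u) \<subseteq> (\<Union>p\<in>P. I p)"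
  using assms
proof (induction U)
  case (insert u U)
  obtain P where P: "finite P" "card P \<le> m" "A u \<subseteq> (\<Union>p\<in>P. I p)"
    using insert.prems[of u] by blast
  obtain Q where Q: "finite Q" "card Q \<le> card U * m" "(\<Union>u\<in>U. A u) \<subseteq> (\<Union>p\<in>Q. I p)"
    using insert.IH insert.prems by blast
  have "card (P \<union> Q) \<le> card (insert u U) * m"
    using card_Un_le[of P Q] P(2) Q(2) insert.hyps by simp
  moreover have "(\<Union>u\<in>insert u U. A u) \<subseteq> (\<Union>p\<in>P \<union> Q. I p)" using P(3) Q(3) by blast
  ultimately show ?case using P(1) Q(1) by (intro exI[of _ "P \<union> Q"]) simp
qed auto

lemma emeasure_interval_cover:
  fixes P :: "real set" and l :: real
  assumes "finite P" "0 \<le> l" "E \<subseteq> (\<Union>p\<in>P. {p..p + l})"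
  shows "emeasure lebesgue E \<le> ennreal (card P * l)"
proof -
  have "emeasure lebesgue E \<le> emeasure lebesgue (\<Union>p\<in>P. {p..p + l})"
    using assms by (intro emeasure_mono) auto
  also have "\<dots> \<le> (\<Sum>p\<in>P. emeasure lebesgue {p..p + l})"
    using assms by (intro emeasure_subadditive_finite) auto
  also have "\<dots> = ennreal (card P * l)"
    using assms by (simp add: ennreal_mult ennreal_of_nat_eq_real_of_nat)
  finally show ?thesis .
qed

section \<open>Upper bound for the exponents\<close>

lemma nondeg_exponent_le:
  fixes F :: "real \<Rightarrow> real ^ 'd::finite"
  assumes "0 < M" and smooth: "smooth_on_interval {-M..M} F" and u: "u \<in> {-M..M}"
    and n: "enat n \<le> d_at F M u" "1 \<le> n" and \<alpha>: "\<alpha> \<in> nondeg_exponents F M"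
  shows "\<alpha> \<le> 1 / n"
proof (rule ccontr)
  obtain m where m: "n = Suc m" using n(2) by (cases n) auto
  obtain \<eta> where \<eta>: "\<eta> \<noteq> 0"
      "\<And>j. 1 \<le> j \<Longrightarrow> j \<le> m \<Longrightarrow> nth_deriv_on {-M..M} (Suc j) F u \<bullet> \<eta> = 0"
    using annihilator_exists n(1) unfolding m by blast
  \<comment> \<open>This choice makes the symbol of \<open>(\<sigma>, \<eta>)\<close> itself vanish
    at \<open>u\<close>; \<open>\<tau>\<close> and \<open>\<xi>\<close> rescale the pair to the unit
    sphere.\<close>
  define \<sigma> where "\<sigma> = - (nth_deriv_on {-M..M} (Suc 0) F u \<bullet> \<eta>)"
  define s where "s = norm (\<sigma>, \<eta>)"
  define \<tau> where "\<tau> = \<sigma> / s"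
  define \<xi> where "\<xi> = (1 / s) *\<^sub>R \<eta>"
  have s: "0 < s" "s\<^sup>2 = \<sigma>\<^sup>2 + (norm \<eta>)\<^sup>2"
    using \<eta>(1) by (simp_all add: s_def norm_Pair add_nonneg_pos)
  have unit: "\<tau>\<^sup>2 + (norm \<xi>)\<^sup>2 = 1"
  proof -
    have "\<tau>\<^sup>2 + (norm \<xi>)\<^sup>2 = (\<sigma>\<^sup>2 + (norm \<eta>)\<^sup>2) / s\<^sup>2"
      by (simp add: \<tau>_def \<xi>_def power_divide add_divide_distrib)
    then show ?thesis using s by (metis divide_self less_irrefl zero_less_power)
  qed
  define g where "g = symbol_deriv F M \<tau> \<xi>"
  have zero: "g j u = 0" if "j < n" for j
    using \<eta>(2)[of j] that
    by (cases "j = 0")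
      (auto simp: g_def symbol_deriv_def m \<tau>_def \<xi>_def \<sigma>_def simp del: nth_deriv_on.simps)
  have "compact (g n ` {-M..M})"
    unfolding g_def by (intro compact_continuous_image continuous_on_symbol_deriv smooth) simp
  then obtain B where B: "0 < B" "\<And>v. v \<in> {-M..M} \<Longrightarrow> \<bar>g n v\<bar> \<le> B"
    using compact_imp_bounded bounded_pos by (metis image_eqI real_norm_def)
  have bound: "\<bar>g 0 v\<bar> \<le> B * \<bar>v - u\<bar> ^ n" if "v \<in> {-M..M}" for v
    using u zero B that unfolding g_def
    by (intro vanishing_order_bound[where S = "{-M..M}"] symbol_deriv_has_derivative smooth)
      (auto simp: is_interval_cc)
  obtain C where C: "0 < C" "\<And>\<delta>. 0 < \<delta> \<Longrightarrow>
      emeasure lebesgue (nondeg_set F M \<delta> \<tau> \<xi>) \<le> ennreal (C * \<delta> powr \<alpha>)" and "0 < \<alpha>"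
    using \<alpha> unit unfolding nondeg_exponents_iff by blast
  \<comment> \<open>With \<open>\<delta> = B * \<rho> ^ n\<close> the assumed bound
    \<open>C * \<delta> powr \<alpha>\<close> equals \<open>D * \<rho> powr (1 + \<beta>)\<close>,
    and \<open>\<beta> > 0\<close> is the negation of the claim.\<close>
  define D where "D = C * B powr \<alpha>"
  define \<beta> where "\<beta> = n * \<alpha> - 1"
  have "0 < D" using C B by (simp add: D_def)
  assume "\<not> \<alpha> \<le> 1 / n"
  then have "0 < \<beta>" using n(2) by (simp add: \<beta>_def field_simps)
  have key: "\<rho> \<le> D * (\<rho> * \<rho> powr \<beta>)" if \<rho>: "0 < \<rho>" "\<rho> \<le> M" for \<rho>
  proof -
    \<comment> \<open>The interval has \<open>u\<close> as an endpoint and points towards the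
      farther end of \<open>[-M, M]\<close>, so it fits whenever
      \<open>\<rho> \<le> M\<close>.\<close>
    define q where "q = (if u \<le> 0 then u else u - \<rho>)"
    have I: "{q..q + \<rho>} \<subseteq> {-M..M}" "\<And>v. v \<in> {q..q + \<rho>} \<Longrightarrow> \<bar>v - u\<bar> \<le> \<rho>"
      using u \<rho> by (auto simp: q_def split: if_splits)
    have "{q..q + \<rho>} \<subseteq> nondeg_set F M (B * \<rho> ^ n) \<tau> \<xi>"
    proof
      fix v assume v: "v \<in> {q..q + \<rho>}"
      have "B * \<bar>v - u\<bar> ^ n \<le> B * \<rho> ^ n"
        using I(2)[OF v] B by (intro mult_left_mono power_mono) auto
      then show "v \<in> nondeg_set F M (B * \<rho> ^ n) \<tau> \<xi>"
        using bound[of v] I(1) v by (auto simp: nondeg_set_altdef g_def)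
    qed
    then have "emeasure lebesgue {q..q + \<rho>}
        \<le> emeasure lebesgue (nondeg_set F M (B * \<rho> ^ n) \<tau> \<xi>)"
      by (intro emeasure_mono nondeg_set_measurable smooth)
    also have "\<dots> \<le> ennreal (C * (B * \<rho> ^ n) powr \<alpha>)" using B \<rho> by (intro C) auto
    finally have "\<rho> \<le> C * (B * \<rho> ^ n) powr \<alpha>"
      using \<rho> C by (simp add: ennreal_le_iff)
    also have "(B * \<rho> ^ n) powr \<alpha> = B powr \<alpha> * \<rho> powr (1 + \<beta>)"
      using B \<rho> by (simp add: powr_mult powr_powr \<beta>_def flip: powr_realpow)
    finally show ?thesis using \<rho> by (simp add: D_def powr_add mult.assoc)
  qed
  \<comment> \<open>Small enough that \<open>D * \<rho> powr \<beta> \<le> 1 / 2\<close>, whereas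
    \<open>key\<close> forces this product to be at least 1.\<close>
  define \<rho> where "\<rho> = min M ((1 / (2 * D)) powr (1 / \<beta>))"
  have \<rho>: "0 < \<rho>" "\<rho> \<le> M" using \<open>0 < M\<close> \<open>0 < D\<close> by (auto simp: \<rho>_def)
  have "\<rho> powr \<beta> \<le> ((1 / (2 * D)) powr (1 / \<beta>)) powr \<beta>"
    using \<rho> \<open>0 < \<beta>\<close> by (intro powr_mono2) (auto simp: \<rho>_def)
  also have "\<dots> = 1 / (2 * D)" using \<open>0 < \<beta>\<close> \<open>0 < D\<close> by (simp add: powr_powr)
  finally have "D * \<rho> powr \<beta> \<le> 1 / 2" using \<open>0 < D\<close> by (simp add: field_simps)
  moreover have "\<rho> * 1 \<le> \<rho> * (D * \<rho> powr \<beta>)" using key[OF \<rho>] by (simp add: mult_ac)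
  then have "1 \<le> D * \<rho> powr \<beta>" using \<rho>(1) by (simp only: mult_le_cancel_left_pos)
  ultimately show False by simp
qed

section \<open>Admissibility of the exponent 1/K\<close>

lemma inverse_nondeg_exponent:
  fixes F :: "real \<Rightarrow> real ^ 'd::finite"
  assumes "0 < M" and smooth: "smooth_on_interval {-M..M} F" and "1 \<le> K"
    and K: "\<And>u. u \<in> {-M..M} \<Longrightarrow> d_at F M u \<le> enat K"
  shows "1 / K \<in> nondeg_exponents F M"
proof -
  \<comment> \<open>The product norm is Euclidean, so the sphere is exactly the set of normalised
    pairs \<open>(\<tau>, \<xi>)\<close>.\<close>
  define X :: "((real \<times> (real ^ 'd)) \<times> real) set" where "X = sphere 0 1 \<times> {-M..M}"
  define \<Phi> where "\<Phi> x = (\<Sum>j\<le>K. \<bar>symbol_deriv F M (fst (fst x)) (snd (fst x)) j (snd x)\<bar>)" for x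
  have "((1, 0), 0) \<in> X" using \<open>0 < M\<close> by (simp add: X_def norm_Pair)
  then have X: "compact X" "X \<noteq> {}" by (auto simp: X_def compact_Times)
  have "continuous_on X (\<lambda>x. nth_deriv_on {-M..M} (Suc j) F (snd x))" for j
    by (rule continuous_on_compose2[OF smooth_continuous_on[OF smooth]])
      (auto simp: X_def intro: continuous_intros)
  moreover have "continuous_on X (\<lambda>x. if j = 0 then fst (fst x) else 0)" for j :: nat
    by (cases "j = 0") (auto intro!: continuous_intros)
  ultimately have "continuous_on X \<Phi>"
    unfolding \<Phi>_def symbol_deriv_def by (intro continuous_intros)
  then obtain x where x: "x \<in> X" "\<And>y. y \<in> X \<Longrightarrow> \<Phi> x \<le> \<Phi> y"
    using continuous_attains_inf[of X \<Phi>] X by blast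
  have unit_iff: "norm (\<tau>, \<xi>) = 1 \<longleftrightarrow> \<tau>\<^sup>2 + (norm \<xi>)\<^sup>2 = 1" for \<tau> :: real and \<xi> :: "real ^ 'd"
    by (simp add: norm_Pair)
  \<comment> \<open>One of the \<open>K + 1\<close> summands of \<open>\<Phi>\<close> is at least
    the average \<open>2 * c\<close>. The factor 2 lets that derivative vary by \<open>c\<close> on
    a short interval and still stay at least \<open>c\<close> in absolute value.\<close>
  define c where "c = \<Phi> x / (2 * (K + 1))"
  have "0 < \<Phi> x"
  proof -
    obtain \<tau> \<xi> u where xe: "x = ((\<tau>, \<xi>), u)" by (metis prod.collapse)
    then have "d_at F M u \<le> enat K" "\<tau>\<^sup>2 + (norm \<xi>)\<^sup>2 = 1"
      using x(1) K by (auto simp: X_def unit_iff)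
    then obtain j where "j \<le> K" "symbol_deriv F M \<tau> \<xi> j u \<noteq> 0"
      using symbol_deriv_nonzero by blast
    then show ?thesis unfolding \<Phi>_def xe by (intro sum_pos2[of _ j]) auto
  qed
  then have "0 < c" by (simp add: c_def)
  have large: "\<exists>j\<le>K. 2 * c \<le> \<bar>symbol_deriv F M \<tau> \<xi> j u\<bar>"
    if "\<tau>\<^sup>2 + (norm \<xi>)\<^sup>2 = 1" "u \<in> {-M..M}" for \<tau> \<xi> u
  proof (rule ccontr)
    assume "\<not> ?thesis"
    then have "\<Phi> ((\<tau>, \<xi>), u) < of_nat (card {..K}) * (2 * c)"
      unfolding \<Phi>_def by (intro sum_bounded_above_strict) auto
    moreover have "\<Phi> x \<le> \<Phi> ((\<tau>, \<xi>), u)" using that by (intro x) (auto simp: X_def unit_iff)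
    moreover have "real (card {..K}) * (2 * c) = \<Phi> x" by (simp add: c_def divide_simps)
    ultimately show False by simp
  qed
  \<comment> \<open>Uniform continuity is used for the derivatives of \<open>F\<close> alone;
    \<open>norm \<xi> \<le> 1\<close> carries it over to the symbol, so the radius is independent of
    \<open>(\<tau>, \<xi>)\<close>.\<close>
  have "\<exists>r>0. \<forall>u\<in>{-M..M}. \<forall>v\<in>{-M..M}. dist v u < r \<longrightarrow>
      dist (nth_deriv_on {-M..M} (Suc j) F v) (nth_deriv_on {-M..M} (Suc j) F u) < c" for j
    using compact_uniformly_continuous[OF smooth_continuous_on[OF smooth, of "Suc j"]] \<open>0 < c\<close>
    by (simp add: uniformly_continuous_on_def del: nth_deriv_on.simps)
  then obtain r where r: "\<And>j. 0 < r j" "\<And>j u v. u \<in> {-M..M} \<Longrightarrow> v \<in> {-M..M} \<Longrightarrow> dist v u < r j \<Longrightarrow>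
      dist (nth_deriv_on {-M..M} (Suc j) F v) (nth_deriv_on {-M..M} (Suc j) F u) < c"
    by metis
  define R where "R = Min (r ` {..K})"
  have R: "0 < R" "\<And>j. j \<le> K \<Longrightarrow> R \<le> r j" using r(1) by (auto simp: R_def)
  obtain U where U: "U \<subseteq> {-M..M}" "finite U" "{-M..M} \<subseteq> (\<Union>u\<in>U. ball u R)"
    by (rule compactE_image[of "{-M..M}" "{-M..M}" "\<lambda>u. ball u R"]) (use R(1) in auto)
  define N where "N = card U * 2 ^ K"
  \<comment> \<open>\<open>2 * N\<close> accounts for \<open>N\<close> intervals of length
    \<open>2 * \<rho>\<close>, \<open>2 * M\<close> for the trivial bound when
    \<open>\<delta>\<close> is large, and the last factor for the constant inside
    \<open>\<rho>\<close>.\<close>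
  define C where "C = (2 * N + 2 * M) * (2 / c) powr (1 / K)"
  have "0 < C" using \<open>0 < M\<close> \<open>0 < c\<close> by (simp add: C_def add_nonneg_pos)
  moreover have "emeasure lebesgue (nondeg_set F M \<delta> \<tau> \<xi>) \<le> ennreal (C * \<delta> powr (1 / K))"
    if "0 < \<delta>" and unit: "\<tau>\<^sup>2 + (norm \<xi>)\<^sup>2 = 1" for \<delta> \<tau> \<xi>
  proof -
    \<comment> \<open>Solves \<open>c * \<rho> ^ K = 2 * \<delta>\<close>; the 2 gives the strict
      inequality required by \<open>sublevel_cover\<close>.\<close>
    define \<rho> where "\<rho> = (2 / c * \<delta>) powr (1 / K)"
    have "0 < \<rho>" using \<open>0 < c\<close> \<open>0 < \<delta>\<close> by (simp add: \<rho>_def)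
    have C_eq: "C * \<delta> powr (1 / K) = (2 * N + 2 * M) * \<rho>"
      using \<open>0 < c\<close> \<open>0 < \<delta>\<close> unfolding C_def \<rho>_def by (subst powr_mult) auto
    show ?thesis
    proof (cases "2 / c * \<delta> \<le> 1")
      case False
      \<comment> \<open>Here \<open>\<rho> \<ge> 1\<close>, and the length \<open>2 * M\<close> of
        the whole interval is already small enough.\<close>
      have "1 powr (1 / K) \<le> \<rho>" unfolding \<rho>_def using False by (intro powr_mono2) auto
      then have "2 * M * 1 \<le> (2 * N + 2 * M) * \<rho>" using \<open>0 < M\<close> by (intro mult_mono) auto
      moreover have "emeasure lebesgue (nondeg_set F M \<delta> \<tau> \<xi>) \<le> emeasure lebesgue {-M..M}"
        by (intro emeasure_mono) (auto simp: nondeg_set_def)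
      ultimately show ?thesis using \<open>0 < M\<close> unfolding C_eq
        by (simp add: ennreal_leI order_trans)
    next
      case True
      \<comment> \<open>Since \<open>\<rho> \<le> 1\<close>, powers decrease with the order, so one
        \<open>\<rho>\<close> serves every \<open>j \<le> K\<close>, whichever derivative is large
        near a given centre.\<close>
      have "\<rho> \<le> 1 powr (1 / K)"
        unfolding \<rho>_def using True \<open>0 < c\<close> \<open>0 < \<delta>\<close> by (intro powr_mono2) auto
      have "\<rho> ^ K = \<rho> powr K" using \<open>0 < \<rho>\<close> by (simp add: powr_realpow)
      also have "\<dots> = 2 / c * \<delta>" using \<open>1 \<le> K\<close> \<open>0 < c\<close> \<open>0 < \<delta>\<close> by (simp add: \<rho>_def powr_powr)
      finally have \<rho>K: "c * \<rho> ^ K = 2 * \<delta>" using \<open>0 < c\<close> by simp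
      have \<delta>_less: "\<delta> < c * \<rho> ^ j" if "j \<le> K" for j
      proof -
        have "c * \<rho> ^ K \<le> c * \<rho> ^ j"
          using \<open>0 < c\<close> \<open>0 < \<rho>\<close> \<open>\<rho> \<le> 1 powr (1 / K)\<close> that
          by (intro mult_left_mono power_decreasing) auto
        then show ?thesis using \<rho>K \<open>0 < \<delta>\<close> by simp
      qed
      define g where "g = symbol_deriv F M \<tau> \<xi>"
      define S where "S u = {-M..M} \<inter> ball u R" for u
      have "norm \<xi> \<le> 1"
        using unit by (metis abs_norm_cancel abs_square_le_1 le_add_same_cancel2 zero_le_power2)
      have "\<exists>P. finite P \<and> card P \<le> 2 ^ K \<and> {v \<in> S u. \<bar>g 0 v\<bar> \<le> \<delta>} \<subseteq> (\<Union>p\<in>P. {p..p + 2 * \<rho>})"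
        if "u \<in> U" for u
      proof -
        have u: "u \<in> {-M..M}" using U that by auto
        obtain j where j: "j \<le> K" "2 * c \<le> \<bar>g j u\<bar>"
          using large[OF unit u] unfolding g_def by auto
        have S: "is_interval (S u)"
          unfolding S_def by (intro is_interval_Int is_interval_cc is_interval_ball_real)
        have der: "(g i has_real_derivative g (Suc i) v) (at v within S u)" if "v \<in> S u" for i v
          using symbol_deriv_has_derivative[OF smooth, of v \<tau> \<xi> i] that
          unfolding g_def S_def by (meson IntD1 has_field_derivative_subset inf_le1)
        have near: "\<bar>g j v - g j u\<bar> \<le> c" if "v \<in> S u" for v
        proof -
          let ?D = "nth_deriv_on {-M..M} (Suc j) F"
          \<comment> \<open>For \<open>j = 0\<close> the constant \<open>\<tau>\<close> cancels in
            the difference.\<close>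
          have "\<bar>g j v - g j u\<bar> = \<bar>(?D v - ?D u) \<bullet> \<xi>\<bar>"
            by (simp add: g_def symbol_deriv_def inner_diff_left del: nth_deriv_on.simps)
          also have "\<dots> \<le> norm (?D v - ?D u) * norm \<xi>" by (rule Cauchy_Schwarz_ineq2)
          also have "\<dots> \<le> norm (?D v - ?D u) * 1"
            using \<open>norm \<xi> \<le> 1\<close> by (intro mult_left_mono) auto
          finally have "\<bar>g j v - g j u\<bar> \<le> norm (?D v - ?D u) * 1" .
          moreover have "dist v u < r j"
            using that R(2)[OF j(1)] unfolding S_def
            by (metis IntD2 dist_commute mem_ball order_less_le_trans)
          then have "norm (?D v - ?D u) < c"
            using r(2)[OF u, of v j] that unfolding S_def dist_norm by blast
          ultimately show ?thesis by linarith
        qed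
        have "\<exists>P. finite P \<and> card P < 2 ^ j \<and> {v \<in> S u. \<bar>g 0 v\<bar> \<le> \<delta>} \<subseteq> (\<Union>p\<in>P. {p..p + 2 * \<rho>})"
        proof (cases "0 \<le> g j u")
          case True
          then have "c \<le> g j v" if "v \<in> S u" for v using near[OF that] j(2) by linarith
          then show ?thesis
            by (intro sublevel_cover[OF S, where c = c] der \<delta>_less j \<open>0 < c\<close> \<open>0 < \<rho>\<close>)
        next
          case False
          then have "c \<le> - g j v" if "v \<in> S u" for v using near[OF that] j(2) by linarith
          then have "\<exists>P. finite P \<and> card P < 2 ^ j \<and>
              {v \<in> S u. \<bar>- g 0 v\<bar> \<le> \<delta>} \<subseteq> (\<Union>p\<in>P. {p..p + 2 * \<rho>})"
            by (intro sublevel_cover[OF S, where c = c and g = "\<lambda>i v. - g i v"]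
                DERIV_minus der \<delta>_less j \<open>0 < c\<close> \<open>0 < \<rho>\<close>)
          then show ?thesis by simp
        qed
        then obtain P where P: "finite P" "card P < 2 ^ j"
            "{v \<in> S u. \<bar>g 0 v\<bar> \<le> \<delta>} \<subseteq> (\<Union>p\<in>P. {p..p + 2 * \<rho>})"
          by (elim exE conjE)
        have "(2::nat) ^ j \<le> 2 ^ K" using j(1) by (intro power_increasing) auto
        with P(2) have "card P \<le> 2 ^ K" by (rule order.trans[OF less_imp_le])
        with P show ?thesis by (intro exI[of _ P] conjI)
      qed
      then have "\<exists>P. finite P \<and> card P \<le> card U * 2 ^ K \<and>
          (\<Union>u\<in>U. {v \<in> S u. \<bar>g 0 v\<bar> \<le> \<delta>}) \<subseteq> (\<Union>p\<in>P. {p..p + 2 * \<rho>})"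
        by (rule UN_cover_card[OF U(2)])
      then obtain P where P: "finite P" "card P \<le> N"
          "(\<Union>u\<in>U. {v \<in> S u. \<bar>g 0 v\<bar> \<le> \<delta>}) \<subseteq> (\<Union>p\<in>P. {p..p + 2 * \<rho>})"
        unfolding N_def by (elim exE conjE)
      have "nondeg_set F M \<delta> \<tau> \<xi> \<subseteq> (\<Union>u\<in>U. {v \<in> S u. \<bar>g 0 v\<bar> \<le> \<delta>})"
        using U(3) unfolding nondeg_set_altdef g_def S_def by blast
      from this P(3) have "nondeg_set F M \<delta> \<tau> \<xi> \<subseteq> (\<Union>p\<in>P. {p..p + 2 * \<rho>})"
        by (rule order.trans)
      then have "emeasure lebesgue (nondeg_set F M \<delta> \<tau> \<xi>) \<le> ennreal (card P * (2 * \<rho>))"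
        using P(1) \<open>0 < \<rho>\<close> by (intro emeasure_interval_cover) simp_all
      also have "\<dots> \<le> ennreal ((2 * N + 2 * M) * \<rho>)"
      proof (rule ennreal_leI)
        have "card P * (2 * \<rho>) \<le> N * (2 * \<rho>)"
          using P(2) \<open>0 < \<rho>\<close> by (intro mult_right_mono) simp_all
        also have "\<dots> \<le> (2 * N + 2 * M) * \<rho>" using \<open>0 < M\<close> \<open>0 < \<rho>\<close> by (simp add: algebra_simps)
        finally show "card P * (2 * \<rho>) \<le> (2 * N + 2 * M) * \<rho>" .
      qed
      finally show ?thesis unfolding C_eq .
    qed
  qed
  ultimately show ?thesis using \<open>1 \<le> K\<close> unfolding nondeg_exponents_iff by auto
qed

section \<open>Attainment of the supremum and conclusion\<close>

text \<open>A set of extended naturals with finite supremum is itself finite, so its supremum is a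
  maximum.\<close>

lemma enat_SUP_attained:
  fixes f :: "'a \<Rightarrow> enat"
  assumes "A \<noteq> {}" "(SUP x\<in>A. f x) \<noteq> \<infinity>"
  shows "\<exists>x\<in>A. (SUP x\<in>A. f x) = f x"
proof -
  have "finite (f ` A)" "f ` A \<noteq> {}" using assms by (auto simp: Sup_enat_def split: if_splits)
  then have "Sup (f ` A) \<in> f ` A" by (simp add: Sup_enat_def)
  then show ?thesis by auto
qed

theorem theorem3p1:
  fixes F :: "real \<Rightarrow> real ^ 'd::finite" and M :: real
  assumes "M > 0"
    and "smooth_on_interval {-M..M} F"
  shows "alpha_sup F M = 1 / ereal_of_enat (d_max F M)
       \<and> 1 / ereal_of_enat (d_max F M) \<le> 1 / ereal (real CARD('d))
       \<and> (alpha_sup F M > 0 \<longrightarrow> (\<exists>u\<in>{-M..M}. d_max F M = d_at F M u))"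
proof (cases "d_max F M")
  case (enat K)
  have ne: "{-M..M} \<noteq> {}" using \<open>M > 0\<close> by simp
  \<comment> \<open>This maximiser is the point claimed by the theorem, and
    \<open>nondeg_exponent_le\<close> at it shows that no exponent exceeds
    \<open>1 / K\<close>.\<close>
  obtain u where u: "u \<in> {-M..M}" "d_max F M = d_at F M u"
    using enat_SUP_attained[OF ne, of "d_at F M"] enat unfolding d_max_def by auto
  have le: "d_at F M v \<le> enat K" if "v \<in> {-M..M}" for v
    using that unfolding enat[symmetric] d_max_def by (rule SUP_upper)
  have card: "CARD('d) \<le> K" using card_le_d_at[of F M u] unfolding u(2)[symmetric] enat by simp
  have pos: "1 \<le> CARD('d)" by (simp add: Suc_le_eq)
  have K: "1 \<le> K" using pos card by (rule order.trans)
  have mem: "1 / K \<in> nondeg_exponents F M"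
    using inverse_nondeg_exponent[OF assms K le] by simp
  moreover have "\<alpha> \<le> 1 / K" if "\<alpha> \<in> nondeg_exponents F M" for \<alpha>
    using nondeg_exponent_le[OF assms u(1) _ _ that, of K] u(2) enat K by simp
  ultimately have "(SUP \<alpha>\<in>nondeg_exponents F M. ereal \<alpha>) = ereal (1 / K)"
    by (intro antisym SUP_least SUP_upper2[OF mem]) auto
  then have "alpha_sup F M = ereal (1 / K)" using mem by (auto simp: alpha_sup_def)
  moreover have "1 / ereal_of_enat (d_max F M) = ereal (1 / K)"
    using K by (simp add: enat one_ereal_def)
  moreover have "1 / ereal (real CARD('d)) = ereal (1 / CARD('d))"
    using pos by (simp add: one_ereal_def)
  moreover have "1 / real K \<le> 1 / CARD('d)" using card K by (intro divide_left_mono) auto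
  ultimately show ?thesis using u by auto
next
  case infinity
  \<comment> \<open>No single point need have infinite \<open>d_at\<close>: for each
    \<open>n\<close> some point, depending on \<open>n\<close>, excludes exponents above 1/(n+1).
    Then \<open>alpha_sup\<close> is 0 by its default case, matching 1/\<infinity> = 0.\<close>
  have "nondeg_exponents F M = {}"
  proof (rule ccontr)
    assume "nondeg_exponents F M \<noteq> {}"
    then obtain \<alpha> where \<alpha>: "\<alpha> \<in> nondeg_exponents F M" by auto
    then have "0 < \<alpha>" by (simp add: nondeg_exponents_iff)
    then obtain n where n: "1 / Suc n < \<alpha>" using nat_approx_posE by blast
    have "enat (Suc n) < (SUP u\<in>{-M..M}. d_at F M u)" using infinity by (simp add: d_max_def)
    then obtain u where "u \<in> {-M..M}" "enat (Suc n) \<le> d_at F M u"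
      unfolding less_SUP_iff by (auto intro: less_imp_le)
    then show False using nondeg_exponent_le[OF assms _ _ _ \<alpha>, of u "Suc n"] n by simp
  qed
  then show ?thesis using infinity by (simp add: alpha_sup_def)
qed

end
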